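(* For every prime number $p$, the Fibonacci polynomial $F_p(x)$, the Pell polynomial $P_p(x)$ and the Fermat polynomial $\Phi_p(x)$ are irreducible over $\mathbb{Q}$.
   Context: The polynomial sequences are defined for $n\ge 2$ by: Fibonacci: $F_0=0$, $F_1=1$, $F_n(x)=xF_{n-1}(x)+F_{n-2}(x)$; Pell: $P_0=0$, $P_1=1$, $P_n(x)=2xP_{n-1}(x)+P_{n-2}(x)$; Fermat: $\Phi_0=0$, $\Phi_1=1$, $\Phi_n(x)=3x\Phi_{n-1}(x)-2\Phi_{n-2}(x)$. *)

theory Defs
  imports "HOL-Computational_Algebra.Computational_Algebra"
begin

fun fibonacci_poly :: "nat \<Rightarrow> rat poly" where
  "fibonacci_poly 0 = 0"
| "fibonacci_poly (Suc 0) = 1"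
| "fibonacci_poly (Suc (Suc n)) = [:0, 1:] * fibonacci_poly (Suc n) + fibonacci_poly n"

fun pell_poly :: "nat \<Rightarrow> rat poly" where
  "pell_poly 0 = 0"
| "pell_poly (Suc 0) = 1"
| "pell_poly (Suc (Suc n)) = [:0, 2:] * pell_poly (Suc n) + pell_poly n"

fun fermat_poly :: "nat \<Rightarrow> rat poly" where
  "fermat_poly 0 = 0"
| "fermat_poly (Suc 0) = 1"
| "fermat_poly (Suc (Suc n)) = [:0, 3:] * fermat_poly (Suc n) - 2 * fermat_poly n"

end

(* All three families are Lucas sequences U_n(c x, q) with q = -1 or q = 2, so up to scaling x it
suffices to treat U_p(x, q) over the integers, for an odd prime p = 2m+1. There U_p(x, q) = G(x^2),
and G(y + 4q) is an Eisenstein polynomial at p, so G is irreducible.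

If U_p = g h, write g = E(x^2) + x O(x^2). The norm E^2 - y O^2 of g times that of h is G^2, so
unless g or h is a unit, E^2 - y O^2 = G up to sign, and the sign is (-1)^m by comparing leading
coefficients. On the other hand U_p = U_(m+1)^2 - q U_m^2 writes G as B^2 - q y C^2 (up to
exchanging the roles of the even and odd parts when m is odd) with C monic. Modulo 2 the two
representations force E = B and O = q C; squaring this gives E^2 - y O^2 = B^2 - q^2 y C^2 modulo 4,
hence 4 divides (q^2 - q) C^2 = 2 C^2, which is impossible. *)

theory Submission
  imports Defs
begin

section \<open>Polynomials over the integers and the rationals\<close>

text \<open>Composition with \<open>l\<close> is a ring automorphism with inverse composition with
  \<open>l'\<close>, so factorizations and units carry over. It serves both the translation by
  \<open>4 * q\<close> and the scaling of x by \<open>c\<close>.\<close>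

lemma irreducible_pcompose:
  fixes f l l' :: "'a :: idom_divide poly"
  assumes "irreducible f" and l: "pcompose l l' = [:0, 1:]" "pcompose l' l = [:0, 1:]"
  shows "irreducible (pcompose f l)"
proof -
  have cancel: "pcompose (pcompose h l) l' = h" "pcompose (pcompose h l') l = h" for h
    using l by (simp_all add: pcompose_assoc [symmetric])
  have unit: "is_unit (pcompose h l)" if "is_unit h" for h
    using that by (metis dvdE dvdI pcompose_1 pcompose_mult)
  have unit': "is_unit (pcompose h l')" if "is_unit h" for h
    using that by (metis dvdE dvdI pcompose_1 pcompose_mult)
  show ?thesis
  proof (rule irreducibleI)
    show "pcompose f l \<noteq> 0"
      using assms(1) cancel(1)[of f] by auto
    show "\<not> is_unit (pcompose f l)"
      using assms(1) cancel(1)[of f] unit' by (metis irreducible_not_unit)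
    fix a b assume "pcompose f l = a * b"
    hence "f = pcompose a l' * pcompose b l'"
      using cancel(1)[of f] by (simp add: pcompose_mult)
    hence "is_unit (pcompose a l') \<or> is_unit (pcompose b l')"
      using assms(1) by (metis irreducible_def)
    thus "is_unit a \<or> is_unit b"
      using unit cancel(2) by metis
  qed
qed

text \<open>Modulo \<open>p\<close> exactly one factor has vanishing constant term. Its lowest
  surviving coefficient, multiplied by the constant term of the other factor, survives in
  \<open>f\<close>, so its index is at least \<open>degree f\<close>. The other factor is then
  constant, and a unit because \<open>f\<close> is monic.\<close>

lemma irreducible_Eisenstein_monic:
  fixes f :: "'a :: idom_divide poly"
  assumes p: "prime_elem p" and monic: "lead_coeff f = 1" and deg: "degree f > 0"
    and dvd: "\<And>i. i < degree f \<Longrightarrow> p dvd coeff f i"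
    and const: "\<not> p ^ 2 dvd coeff f 0"
  shows "irreducible f"
proof (rule irreducibleI)
  show "f \<noteq> 0" "\<not> is_unit f"
    using deg by (auto simp: is_unit_poly_iff)
next
  have unit: "is_unit b"
    if f: "f = a * b" and a0: "p dvd coeff a 0" and b0: "\<not> p dvd coeff b 0" for a b
  proof -
    have lead: "lead_coeff a * lead_coeff b = 1"
      using monic f by (simp add: lead_coeff_mult)
    hence nz: "a \<noteq> 0" "b \<noteq> 0" by auto
    have "\<not> p dvd lead_coeff a"
      using lead p by (metis dvd_mult2 prime_elem_not_unit)
    define i where "i = (LEAST i. \<not> p dvd coeff a i)"
    have i: "\<not> p dvd coeff a i"
      unfolding i_def by (rule LeastI) fact
    have below: "p dvd coeff a j" if "j < i" for j
      using that not_less_Least unfolding i_def by blast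
    have i_le: "i \<le> degree a"
      unfolding i_def by (rule Least_le) fact
    have "coeff f i = (\<Sum>j<i. coeff a j * coeff b (i - j)) + coeff a i * coeff b 0"
      by (simp add: f coeff_mult lessThan_Suc_atMost [symmetric])
    moreover have "p dvd (\<Sum>j<i. coeff a j * coeff b (i - j))"
      by (intro dvd_sum dvd_mult2 below) auto
    moreover have "\<not> p dvd coeff a i * coeff b 0"
      using i b0 p by (simp add: prime_elem_dvd_mult_iff)
    ultimately have "\<not> p dvd coeff f i"
      by (metis dvd_add_right_iff)
    hence "degree f \<le> i"
      using dvd not_less by blast
    moreover have "degree f = degree a + degree b"
      using nz by (simp add: f degree_mult_eq)
    ultimately have "degree b = 0"
      using i_le by linarith
    then obtain c where "b = [:c:]"
      by (auto elim: degree_eq_zeroE)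
    thus "is_unit b"
      using lead by (auto simp: is_unit_const_poly_iff intro: dvdI[of _ _ "lead_coeff a"] simp: mult.commute)
  qed
  fix a b assume f: "f = a * b"
  hence const_ab: "coeff f 0 = coeff a 0 * coeff b 0"
    by (simp add: coeff_mult)
  have "p dvd coeff a 0 \<or> p dvd coeff b 0"
    using dvd[OF deg] p by (simp add: const_ab prime_elem_dvd_mult_iff)
  moreover have "\<not> (p dvd coeff a 0 \<and> p dvd coeff b 0)"
    using const by (auto simp: const_ab power2_eq_square intro: mult_dvd_mono)
  ultimately show "is_unit a \<or> is_unit b"
    using unit[of a b] unit[of b a] f by (auto simp: mult.commute)
qed

section \<open>From integer to rational coefficients\<close>

abbreviation rat_poly :: "int poly \<Rightarrow> rat poly"
  where "rat_poly \<equiv> map_poly of_int"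

lemma coeff_rat_poly [simp]: "coeff (rat_poly f) n = of_int (coeff f n)"
  by (simp add: coeff_map_poly)

lemma rat_poly_mult: "rat_poly (f * g) = rat_poly f * rat_poly g"
  by (rule poly_eqI) (simp add: coeff_mult)

lemma rat_poly_diff: "rat_poly (f - g) = rat_poly f - rat_poly g"
  by (rule poly_eqI) simp

lemma degree_rat_poly [simp]: "degree (rat_poly f) = degree f"
  by (rule degree_map_poly) simp

lemma rat_poly_eq_iff [simp]: "rat_poly f = rat_poly g \<longleftrightarrow> f = g"
  by (auto simp: poly_eq_iff)

lemma rat_poly_clear_denominators:
  fixes f :: "rat poly"
  obtains c :: int and g where "c \<noteq> 0" "smult (of_int c) f = rat_poly g"
proof -
  have "\<exists>c g. c \<noteq> 0 \<and> smult (of_int c) f = rat_poly g"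
  proof (induction f)
    case 0
    show ?case by (intro exI[of _ 1] exI[of _ 0]) simp
  next
    case (pCons a f)
    then obtain c g where cg: "c \<noteq> 0" "smult (of_int c) f = rat_poly g" by blast
    obtain m n where a: "a = of_int m / of_int n" "n > 0"
      by (metis Fract_of_int_quotient Rat_cases)
    have "smult (of_int (c * n)) (pCons a f) = rat_poly (pCons (c * m) (smult n g))"
      using a by (simp add: map_poly_pCons map_poly_smult cg(2) [symmetric] mult.commute)
    thus ?case using cg(1) a(2) by (metis mult_eq_0_iff less_irrefl)
  qed
  thus thesis using that by blast
qed

text \<open>A form of Gauss's lemma by way of primality: an irreducible integer polynomial is prime,
  so after clearing denominators it divides one of the two factors. That factor has full degree,
  which leaves a nonzero constant for the other.\<close>

lemma irreducible_rat_poly: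
  assumes f: "irreducible f" and deg: "degree f > 0"
  shows "irreducible (rat_poly f)"
proof (rule irreducibleI)
  show "rat_poly f \<noteq> 0" "\<not> is_unit (rat_poly f)"
    using deg by (auto simp: is_unit_poly_iff dest!: arg_cong[of _ _ degree])
  have unit: "is_unit h"
    if gh: "rat_poly f = g * h" and cg: "c \<noteq> 0" "smult (of_int c) g = rat_poly g'"
      and dvd: "f dvd g'" for c :: int and g h g'
  proof -
    have nz: "g \<noteq> 0" "h \<noteq> 0"
      using gh deg by (auto dest: arg_cong[of _ _ degree])
    have "degree g' = degree g"
      using arg_cong[OF cg(2), of degree] cg(1) by simp
    moreover have "g' \<noteq> 0"
      using cg nz by auto
    ultimately have "degree f \<le> degree g"
      using dvd by (metis dvd_imp_degree_le)
    moreover have "degree f = degree g + degree h"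
      using arg_cong[OF gh, of degree] nz by (simp add: degree_mult_eq)
    ultimately show "is_unit h"
      using nz by (simp add: is_unit_iff_degree)
  qed
  fix g h assume gh: "rat_poly f = g * h"
  obtain c g' where g': "c \<noteq> 0" "smult (of_int c) g = rat_poly g'"
    by (rule rat_poly_clear_denominators)
  obtain d h' where h': "d \<noteq> 0" "smult (of_int d) h = rat_poly h'"
    by (rule rat_poly_clear_denominators)
  have "rat_poly (smult (c * d) f) = rat_poly (g' * h')"
    using g' h' by (simp add: rat_poly_mult map_poly_smult gh mult_ac flip: g' h')
  hence "f dvd g' * h'"
    by (metis dvd_smult dvd_refl rat_poly_eq_iff)
  hence "f dvd g' \<or> f dvd h'"
    using irreducible_imp_prime_poly[OF f] prime_elem_dvd_multD by blast
  thus "is_unit g \<or> is_unit h"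
    using unit[OF gh g'] unit[of h g, OF _ h'] gh by (auto simp: mult.commute)
qed

section \<open>Even and odd parts of a polynomial\<close>

abbreviation X2 :: "'a :: comm_ring_1 poly"
  where "X2 \<equiv> [:0, 0, 1:]"

lemma coeff_pcompose_X2:
  "coeff (pcompose f X2) (2 * n) = coeff f n"
  "coeff (pcompose f X2) (Suc (2 * n)) = 0"
proof (induction f arbitrary: n)
  case (pCons a f)
  {
    case 1
    show ?case using pCons by (cases n) (simp_all add: pcompose_pCons)
  next
    case 2
    show ?case using pCons by (cases n) (simp_all add: pcompose_pCons)
  }
qed simp_all

lemma poly_even_odd_parts:
  obtains E O' where "f = pcompose E X2 + [:0, 1:] * pcompose O' X2"
proof -
  have "\<exists>E O'. f = pcompose E X2 + [:0, 1:] * pcompose O' X2"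
  proof (induction f)
    case 0
    show ?case by (intro exI[of _ 0]) simp
  next
    case (pCons a f)
    then obtain E O' where "f = pcompose E X2 + [:0, 1:] * pcompose O' X2" by blast
    \<comment> \<open>Multiplication by x exchanges the parts: the odd part, times x^2 and plus
      \<open>a\<close>, becomes the even one.\<close>
    hence "pCons a f = pcompose (pCons a O') X2 + [:0, 1:] * pcompose E X2"
      by (simp add: pcompose_pCons)
    thus ?case by blast
  qed
  thus thesis using that by blast
qed

lemma coeff_even_odd_parts:
  "coeff (pcompose A X2 + [:0, 1:] * pcompose B X2) (2 * n) = coeff A n"
  "coeff (pcompose A X2 + [:0, 1:] * pcompose B X2) (Suc (2 * n)) = coeff B n"
proof -
  have "coeff ([:0, 1:] * pcompose B X2) (2 * n) = 0"
  proof (cases n)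
    case (Suc k)
    thus ?thesis using coeff_pcompose_X2(2)[of B k] by simp
  qed simp
  thus "coeff (pcompose A X2 + [:0, 1:] * pcompose B X2) (2 * n) = coeff A n"
    by (simp only: coeff_add coeff_pcompose_X2 add_0_right)
  show "coeff (pcompose A X2 + [:0, 1:] * pcompose B X2) (Suc (2 * n)) = coeff B n"
    by (simp add: coeff_pcompose_X2)
qed

lemma even_odd_parts_eq_iff:
  "pcompose A X2 + [:0, 1:] * pcompose B X2 = pcompose C X2 + [:0, 1:] * pcompose D X2 \<longleftrightarrow>
     A = C \<and> B = D"
proof
  assume eq: "pcompose A X2 + [:0, 1:] * pcompose B X2 = pcompose C X2 + [:0, 1:] * pcompose D X2"
  have "coeff A n = coeff C n" "coeff B n = coeff D n" for n
    using coeff_even_odd_parts[of A B n] unfolding eq coeff_even_odd_parts by simp_all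
  thus "A = C \<and> B = D" by (simp add: poly_eq_iff)
qed simp

section \<open>Norm forms modulo 2 and 4\<close>

text \<open>Replacing the variable by x^2 turns the form, modulo 2, into the square of A(x^2) + x
  B(x^2). As 2 is prime, it divides this polynomial, whose coefficients interleave those of
  \<open>A\<close> and \<open>B\<close>.\<close>

lemma two_dvd_sum_squares:
  fixes A B :: "int poly"
  assumes "[:2:] dvd A ^ 2 + [:0, 1:] * B ^ 2"
  shows "[:2:] dvd A" "[:2:] dvd B"
proof -
  let ?f = "pcompose A X2 + [:0, 1:] * pcompose B X2"
  obtain k where k: "A ^ 2 + [:0, 1:] * B ^ 2 = [:2:] * k"
    using assms by (auto elim: dvdE)
  have "pcompose A X2 ^ 2 + X2 * pcompose B X2 ^ 2 = [:2:] * pcompose k X2"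
    using arg_cong[OF k, of "\<lambda>f. pcompose f X2"]
    by (simp add: pcompose_add pcompose_mult pcompose_pCons pcompose_smult power2_eq_square)
  hence "pcompose A X2 ^ 2 + [:0, 1:] ^ 2 * pcompose B X2 ^ 2 = 2 * pcompose k X2"
    by (simp add: numeral_poly power2_eq_square)
  moreover have "(a + x * b) ^ 2 = (a ^ 2 + x ^ 2 * b ^ 2) + 2 * (x * a * b)"
    for a b x :: "int poly"
    by (simp add: power2_eq_square algebra_simps)
  ultimately have "?f ^ 2 = 2 * (pcompose k X2 + [:0, 1:] * pcompose A X2 * pcompose B X2)"
    by (simp only: distrib_left)
  also have "2 = [:2 :: int:]" by (simp add: numeral_poly)
  finally have "[:2:] dvd ?f ^ 2" by (simp only: dvd_triv_left)
  moreover have "prime_elem ([:2:] :: int poly)"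
    by (simp add: prime_elem_const_poly_iff)
  ultimately have f: "[:2:] dvd ?f"
    using prime_elem_dvd_power by blast
  have "2 dvd coeff A n" "2 dvd coeff B n" for n
    using f coeff_even_odd_parts[of A B n] by (metis const_poly_dvd_iff)+
  thus "[:2:] dvd A" "[:2:] dvd B" by (simp_all add: const_poly_dvd_iff)
qed

text \<open>Pure ring identities, over an abstract domain so that \<open>y\<close>, \<open>q\<close>
  and 2 stay opaque under simplification. The first yields the congruences modulo 2; the second
  feeds them back and compares modulo 4, where q^2 - q = 2 leaves the term 2 y C^2.\<close>

lemma square_diff_mod_4:
  fixes E O' B C q y :: "'a :: idom"
  assumes "q * q = q + 2" "E ^ 2 - y * O' ^ 2 = B ^ 2 - q * y * C ^ 2"
  shows "(E - B) ^ 2 + y * (O' - q * C) ^ 2 =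
           2 * (y * O' ^ 2 + B ^ 2 + y * C ^ 2 - E * B - y * q * O' * C)"
    and "E - B = 2 * a \<Longrightarrow> O' - q * C = 2 * b \<Longrightarrow>
           2 * (y * C ^ 2) = 2 * (2 * (a ^ 2 + B * a - y * (b ^ 2 + q * b * C)))"
proof -
  have E: "E ^ 2 = y * O' ^ 2 + (B ^ 2 - q * y * C ^ 2)"
    using assms(2) by (simp add: diff_eq_eq)
  have "(E - B) ^ 2 + y * (O' - q * C) ^ 2 =
          E ^ 2 + B ^ 2 - 2 * E * B + y * (O' ^ 2 - 2 * q * O' * C + q * q * C ^ 2)"
    by (simp add: power2_eq_square algebra_simps)
  also have "\<dots> = 2 * (y * O' ^ 2 + B ^ 2 + y * C ^ 2 - E * B - y * q * O' * C)"
    unfolding E assms(1) by (simp add: algebra_simps)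
  finally show "(E - B) ^ 2 + y * (O' - q * C) ^ 2 = \<dots>" .
next
  assume "E - B = 2 * a" "O' - q * C = 2 * b"
  hence ab: "E = B + 2 * a" "O' = q * C + 2 * b"
    by (simp_all add: diff_eq_eq add.commute)
  have "2 * (2 * (a ^ 2 + B * a - y * (b ^ 2 + q * b * C))) =
          E ^ 2 - y * O' ^ 2 - B ^ 2 + y * (q * q) * C ^ 2"
    unfolding ab by (simp add: power2_eq_square algebra_simps)
  also have "\<dots> = 2 * (y * C ^ 2)"
    unfolding assms by (simp add: algebra_simps)
  finally show "2 * (y * C ^ 2) = 2 * (2 * (a ^ 2 + B * a - y * (b ^ 2 + q * b * C)))" ..
qed

lemma sum_squares_congruence:
  fixes E O' B C :: "int poly" and q :: int
  assumes q: "q * q = q + 2"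
    and eq: "E ^ 2 - [:0, 1:] * O' ^ 2 = B ^ 2 - [:0, q:] * C ^ 2"
  shows "[:2:] dvd C"
proof -
  let ?y = "[:0, 1:] :: int poly" and ?q = "[:q:]" and ?t = "[:2:] :: int poly"
  have t: "?t = 2" by (simp add: numeral_poly)
  have qy: "[:0, q:] = ?q * ?y" by simp
  have qq: "?q * ?q = ?q + 2"
    using q by (simp add: numeral_poly)
  have "(E - B) ^ 2 + ?y * (O' - ?q * C) ^ 2 =
          2 * (?y * O' ^ 2 + B ^ 2 + ?y * C ^ 2 - E * B - ?y * ?q * O' * C)"
    by (rule square_diff_mod_4(1)[OF qq eq[unfolded qy]])
  hence "?t dvd (E - B) ^ 2 + ?y * (O' - ?q * C) ^ 2"
    unfolding t by (simp only: dvd_triv_left)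
  from two_dvd_sum_squares[OF this] obtain a b
    where ab: "E - B = 2 * a" "O' - ?q * C = 2 * b"
    unfolding t by (auto elim!: dvdE)
  have "2 * (?y * C ^ 2) = 2 * (2 * (a ^ 2 + B * a - ?y * (b ^ 2 + ?q * b * C)))"
    by (rule square_diff_mod_4(2)[OF qq eq[unfolded qy] ab])
  hence "?y * C ^ 2 = 2 * (a ^ 2 + B * a - ?y * (b ^ 2 + ?q * b * C))"
    by (simp only: mult_cancel_left) simp
  hence "?t dvd ?y * C ^ 2"
    unfolding t by (simp only: dvd_triv_left)
  moreover have prime: "prime_elem ?t"
    by (simp add: prime_elem_const_poly_iff)
  moreover have "\<not> ?t dvd ?y"
    by (auto simp: const_poly_dvd_iff coeff_pCons split: nat.splits)
  ultimately show ?thesis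
    by (metis prime_elem_dvd_multD prime_elem_dvd_power)
qed

text \<open>The two terms have degrees of opposite parity, so their leading terms cannot cancel. The
  parity of the degree of \<open>R\<close> tells which one dominates, and hence the sign.\<close>

lemma sgn_lead_coeff_square_diff:
  fixes A B R :: "'a :: linordered_idom poly"
  assumes R: "A ^ 2 - [:0, 1:] * B ^ 2 = R" and "R \<noteq> 0"
  shows "(- 1) ^ degree R * lead_coeff R > 0"
proof -
  have sq: "lead_coeff (A ^ 2) > 0" if "A \<noteq> 0" for A :: "'a poly"
    using that by (simp add: lead_coeff_power)
  have dA: "degree (A ^ 2) = 2 * degree A"
    by (cases "A = 0") (simp_all add: degree_power_eq)
  have dB: "degree ([:0, 1:] * B ^ 2) = Suc (2 * degree B)" if "B \<noteq> 0"
    using that by (simp add: degree_mult_eq degree_power_eq)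
  have lB: "lead_coeff ([:0, 1:] * B ^ 2) = lead_coeff (B ^ 2)"
    by (simp add: lead_coeff_mult)
  consider "B = 0" | "B \<noteq> 0" "A = 0" | "B \<noteq> 0" "degree (A ^ 2) < degree ([:0, 1:] * B ^ 2)"
    | "B \<noteq> 0" "A \<noteq> 0" "degree ([:0, 1:] * B ^ 2) < degree (A ^ 2)"
  proof -
    have "degree (A ^ 2) \<noteq> degree ([:0, 1:] * B ^ 2)" if "B \<noteq> 0"
      unfolding dA dB[OF that] by presburger
    thus ?thesis using that by (metis linorder_neqE_nat)
  qed
  thus ?thesis
  proof cases
    case 1
    thus ?thesis using R \<open>R \<noteq> 0\<close> dA sq[of A] by auto
  next
    case 2
    hence "R = - ([:0, 1:] * B ^ 2)" using R by simp
    thus ?thesis using 2 dB sq[of B] lB by (simp only: degree_minus coeff_minus) simp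
  next
    case 3
    hence "degree R = degree ([:0, 1:] * B ^ 2)"
          "lead_coeff R = - lead_coeff ([:0, 1:] * B ^ 2)"
      using degree_add_eq_right[of "A ^ 2" "- ([:0, 1:] * B ^ 2)"]
            lead_coeff_add_le[of "A ^ 2" "- ([:0, 1:] * B ^ 2)"] R
      by (simp_all only: degree_minus coeff_minus diff_conv_add_uminus)
    thus ?thesis using 3 dB sq[of B] lB by simp
  next
    case 4
    hence "degree R = degree (A ^ 2)" "lead_coeff R = lead_coeff (A ^ 2)"
      using degree_add_eq_left[of "- ([:0, 1:] * B ^ 2)" "A ^ 2"]
            lead_coeff_add_le[of "- ([:0, 1:] * B ^ 2)" "A ^ 2"] R
      by (simp_all only: degree_minus coeff_minus diff_conv_add_uminus add.commute)
    thus ?thesis using 4 dA sq[of A] by simp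
  qed
qed

section \<open>Irreducibility of G(x^2) by norms\<close>

text \<open>The norms of two factors multiply to G^2, and the prime \<open>G\<close> divides one of
  them, say with cofactor \<open>L\<close>. By \<open>no_norm\<close>, \<open>L\<close> is not a
  unit; since \<open>G\<close> is \<open>L\<close> times the other norm, that norm is a unit, and so
  is the other factor.\<close>

lemma irreducible_pcompose_X2:
  fixes G :: "int poly"
  assumes G: "irreducible G"
    and no_norm: "\<And>E O' L. is_unit L \<Longrightarrow> E ^ 2 - [:0, 1:] * O' ^ 2 \<noteq> L * G"
  shows "irreducible (pcompose G X2)"
proof (rule irreducibleI)
  let ?even_odd = "\<lambda>A B :: int poly. pcompose A X2 + [:0, 1:] * pcompose B X2"
  \<comment> \<open>Multiplication in Z[y][x] with x^2 = y.\<close>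
  have mult: "?even_odd A B * ?even_odd C D =
                ?even_odd (A * C + [:0, 1:] * (B * D)) (A * D + B * C)" for A B C D
  proof -
    have y: "pcompose [:0, 1:] X2 = [:0, 1:] * ([:0, 1:] :: int poly)"
      by (simp add: pcompose_pCons)
    show ?thesis
      by (simp only: pcompose_add pcompose_mult y algebra_simps)
  qed
  have pure: "pcompose A X2 = ?even_odd A 0" for A by simp
  show "pcompose G X2 \<noteq> 0"
    using even_odd_parts_eq_iff[of G 0 0 0] G by auto
  show "\<not> is_unit (pcompose G X2)"
  proof
    assume "is_unit (pcompose G X2)"
    then obtain k where k: "1 = pcompose G X2 * k" by (rule dvdE)
    obtain A B where "k = ?even_odd A B" by (rule poly_even_odd_parts)
    hence "?even_odd 1 0 = ?even_odd G 0 * ?even_odd A B"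
      unfolding pure [symmetric] pcompose_1 using k by simp
    hence "?even_odd 1 0 = ?even_odd (G * A) (G * B)"
      unfolding mult by simp
    hence "1 = G * A" unfolding even_odd_parts_eq_iff by blast
    thus False using G by (metis dvdI irreducible_not_unit)
  qed
  have unit: "is_unit h"
    if h: "h = ?even_odd E' O''" and K: "G dvd E ^ 2 - [:0, 1:] * O' ^ 2"
      and eq: "(E ^ 2 - [:0, 1:] * O' ^ 2) * (E' ^ 2 - [:0, 1:] * O'' ^ 2) = G ^ 2"
    for h E' O'' E O'
  proof -
    obtain L where L: "E ^ 2 - [:0, 1:] * O' ^ 2 = G * L"
      using K by (rule dvdE)
    hence "G * (L * (E' ^ 2 - [:0, 1:] * O'' ^ 2)) = G * G"
      using eq by (simp only: power2_eq_square mult.assoc)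
    hence "G = L * (E' ^ 2 - [:0, 1:] * O'' ^ 2)"
      using G by (metis mult_left_cancel irreducible_def)
    moreover have "\<not> is_unit L"
      using no_norm[of L E O'] L by (metis mult.commute)
    ultimately have "is_unit (E' ^ 2 - [:0, 1:] * O'' ^ 2)"
      using G by (metis irreducible_def)
    then obtain u where u: "1 = (E' ^ 2 - [:0, 1:] * O'' ^ 2) * u" by (rule dvdE)
    \<comment> \<open>The conjugate of \<open>h\<close> under x -> -x turns an inverse of the norm
      into an inverse of \<open>h\<close>.\<close>
    have "h * ?even_odd E' (- O'') = ?even_odd (E' ^ 2 - [:0, 1:] * O'' ^ 2) 0"
      unfolding h mult even_odd_parts_eq_iff by (simp only: power2_eq_square) simp
    hence "h * ?even_odd E' (- O'') * pcompose u X2 =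
             pcompose (E' ^ 2 - [:0, 1:] * O'' ^ 2) X2 * pcompose u X2"
      by (simp only: pure [symmetric])
    also have "\<dots> = 1"
      by (simp only: pcompose_mult [symmetric] u [symmetric] pcompose_1)
    finally show ?thesis
      unfolding mult.assoc by (rule dvdI[OF sym])
  qed
  fix g h :: "int poly" assume gh: "pcompose G X2 = g * h"
  obtain E O' where g: "g = ?even_odd E O'" by (rule poly_even_odd_parts)
  obtain E' O'' where h: "h = ?even_odd E' O''" by (rule poly_even_odd_parts)
  have "?even_odd G 0 = ?even_odd (E * E' + [:0, 1:] * (O' * O'')) (E * O'' + O' * E')"
    unfolding mult [symmetric] g [symmetric] h [symmetric] gh [symmetric] by simp
  hence parts: "G = E * E' + [:0, 1:] * (O' * O'')" "E * O'' + O' * E' = 0"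
    unfolding even_odd_parts_eq_iff by auto
  have brahmagupta: "(a ^ 2 - y * b ^ 2) * (c ^ 2 - y * d ^ 2) =
                       (a * c + y * (b * d)) ^ 2 - y * (a * d + b * c) ^ 2"
    for a b c d y :: "int poly"
    by (simp add: power2_eq_square algebra_simps)
  \<comment> \<open>The second square in the identity vanishes because G(x^2) has no odd
    part.\<close>
  have eq: "(E ^ 2 - [:0, 1:] * O' ^ 2) * (E' ^ 2 - [:0, 1:] * O'' ^ 2) = G ^ 2"
    unfolding brahmagupta parts(2) parts(1) [symmetric] by simp
  have "prime_elem G"
    using G by (rule irreducible_imp_prime_poly)
  hence "G dvd E ^ 2 - [:0, 1:] * O' ^ 2 \<or> G dvd E' ^ 2 - [:0, 1:] * O'' ^ 2"
    by (rule prime_elem_dvd_multD) (simp only: eq dvd_triv_left power2_eq_square[of G])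
  thus "is_unit g \<or> is_unit h"
  proof
    assume "G dvd E ^ 2 - [:0, 1:] * O' ^ 2"
    from unit[OF h this eq] show ?thesis ..
  next
    assume "G dvd E' ^ 2 - [:0, 1:] * O'' ^ 2"
    from unit[OF g this] have "is_unit g"
      using eq by (simp only: mult.commute)
    thus ?thesis ..
  qed
qed

section \<open>Lucas sequences\<close>

fun lucas :: "'a :: comm_ring_1 \<Rightarrow> 'a \<Rightarrow> nat \<Rightarrow> 'a" where
  "lucas P Q 0 = 0"
| "lucas P Q (Suc 0) = 1"
| "lucas P Q (Suc (Suc n)) = P * lucas P Q (Suc n) - Q * lucas P Q n"

text \<open>For \<open>y = P\<^sup>2\<close> this is \<open>U\<^bsub>2k+1\<^esub>(P, Q)\<close>, see \<open>lucas_bisection\<close>.\<close>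

definition lucas_odd :: "'a :: comm_ring_1 \<Rightarrow> 'a \<Rightarrow> nat \<Rightarrow> 'a" where
  "lucas_odd y Q k = lucas (y - 2 * Q) (Q ^ 2) (Suc k) + Q * lucas (y - 2 * Q) (Q ^ 2) k"

text \<open>If P = a + b and Q = a b, the terms of even index form a Lucas-type sequence with roots
  a^2 and b^2, whose sum is P^2 - 2Q and whose product is Q^2.\<close>

lemma lucas_bisection:
  "lucas P Q (2 * k) = P * lucas (P ^ 2 - 2 * Q) (Q ^ 2) k"
  "lucas P Q (Suc (2 * k)) = lucas_odd (P ^ 2) Q k"
proof (induction k)
  case (Suc k)
  {
    case 1
    show ?case using Suc by (simp add: lucas_odd_def algebra_simps)
  next
    case 2
    show ?case using Suc by (simp add: lucas_odd_def algebra_simps power2_eq_square)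
  }
qed (simp_all add: lucas_odd_def)

lemma lucas_add:
  "lucas P Q (Suc (m + n)) =
     lucas P Q (Suc m) * lucas P Q (Suc n) - Q * lucas P Q m * lucas P Q n"
proof (induction P Q m rule: lucas.induct)
  case (3 P Q m)
  have "lucas P Q (Suc (Suc (Suc m) + n)) =
          P * lucas P Q (Suc (Suc m + n)) - Q * lucas P Q (Suc (m + n))"
    by simp
  also have "\<dots> = lucas P Q (Suc (Suc (Suc m))) * lucas P Q (Suc n)
                    - Q * lucas P Q (Suc (Suc m)) * lucas P Q n"
    unfolding 3 by (simp add: algebra_simps)
  finally show ?case .
qed simp_all

lemma lucas_Suc_double:
  "lucas P Q (Suc (2 * k)) = lucas P Q (Suc k) ^ 2 - Q * lucas P Q k ^ 2"
  using lucas_add[of P Q k k] by (simp add: mult_2 power2_eq_square mult.assoc)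

lemma lucas_double:
  "lucas P Q (2 * k) = lucas P Q k * (2 * lucas P Q (Suc k) - P * lucas P Q k)"
proof (cases k)
  case (Suc n)
  \<comment> \<open>The addition formula has an extra 1 in its index, so the summands must be n + 1
    and n.\<close>
  have "2 * Suc n = Suc (Suc n + n)" by simp
  thus ?thesis
    by (simp only: Suc lucas_add lucas.simps(3)) (simp add: algebra_simps del: lucas.simps)
qed simp

text \<open>For even index this is the representation B^2 - Q y C^2: with y = P^2 it is
  \<open>lucas_Suc_double\<close> at an even argument, but here \<open>y\<close> need not be a
  square.\<close>

lemma lucas_odd_double:
  "lucas_odd y Q (2 * k) = lucas_odd y Q k ^ 2 - Q * y * lucas (y - 2 * Q) (Q ^ 2) k ^ 2"
  unfolding lucas_odd_def lucas_Suc_double lucas_double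
  by (simp add: power2_eq_square algebra_simps del: lucas.simps)

text \<open>The counterpart for odd index, where the factor \<open>y\<close> sits on the other
  square.\<close>

lemma lucas_odd_Suc_double:
  "lucas_odd y Q (Suc (2 * k)) =
     y * lucas (y - 2 * Q) (Q ^ 2) (Suc k) ^ 2 - Q * lucas_odd y Q k ^ 2"
proof -
  have "lucas (y - 2 * Q) (Q ^ 2) (Suc (Suc (2 * k))) =
          lucas (y - 2 * Q) (Q ^ 2) (Suc k) *
          (2 * lucas (y - 2 * Q) (Q ^ 2) (Suc (Suc k)) -
             (y - 2 * Q) * lucas (y - 2 * Q) (Q ^ 2) (Suc k))"
    using lucas_double[of "y - 2 * Q" "Q ^ 2" "Suc k"] by simp
  hence "lucas_odd y Q (Suc (2 * k)) =
          lucas (y - 2 * Q) (Q ^ 2) (Suc k) *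
          (2 * lucas (y - 2 * Q) (Q ^ 2) (Suc (Suc k)) -
             (y - 2 * Q) * lucas (y - 2 * Q) (Q ^ 2) (Suc k)) +
          Q * (lucas (y - 2 * Q) (Q ^ 2) (Suc k) ^ 2 - Q ^ 2 * lucas (y - 2 * Q) (Q ^ 2) k ^ 2)"
    by (simp only: lucas_odd_def lucas_Suc_double)
  thus ?thesis
    unfolding lucas_odd_def lucas.simps(3)
    by (simp add: power2_eq_square algebra_simps del: lucas.simps)
qed

lemma pcompose_lucas: "pcompose (lucas P Q n) f = lucas (pcompose P f) (pcompose Q f) n"
  by (induction P Q n rule: lucas.induct) (simp_all add: pcompose_diff pcompose_mult pcompose_1)

lemma pcompose_lucas_odd:
  "pcompose (lucas_odd y Q n) f = lucas_odd (pcompose y f) (pcompose Q f) n"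
  by (simp only: lucas_odd_def pcompose_lucas pcompose_add pcompose_diff pcompose_mult
        power2_eq_square mult_2)

lemma rat_poly_lucas: "rat_poly (lucas P Q n) = lucas (rat_poly P) (rat_poly Q) n"
  by (induction P Q n rule: lucas.induct) (simp_all add: rat_poly_diff rat_poly_mult)

section \<open>Coefficients and degrees of Lucas polynomials\<close>

text \<open>The factor \<open>q ^ Suc j\<close> avoids a truncated exponent \<open>k - 1 - j\<close> on the right.\<close>

lemma coeff_lucas_shifted:
  fixes q :: "'a :: comm_ring_1"
  shows "q ^ Suc j * coeff (lucas [:2 * q, 1:] [:q ^ 2:] k) j =
           q ^ k * of_nat ((k + j) choose Suc (2 * j))"
proof (induction k arbitrary: j rule: induct_nat_012)
  case 1
  show ?case by (cases j) (simp_all add: coeff_pCons binomial_eq_0)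
next
  case (ge2 n)
  let ?u = "\<lambda>k. coeff (lucas [:2 * q, 1:] [:q ^ 2:] k)"
  let ?b = "\<lambda>n k. of_nat (n choose k) :: 'a"
  have "q ^ Suc j * ?u (Suc (Suc n)) j =
          2 * q * (q ^ Suc j * ?u (Suc n) j) - q ^ 2 * (q ^ Suc j * ?u n j)
          + q ^ Suc j * coeff (pCons 0 (lucas [:2 * q, 1:] [:q ^ 2:] (Suc n))) j"
    by (simp add: algebra_simps)
  also have "q ^ Suc j * coeff (pCons 0 (lucas [:2 * q, 1:] [:q ^ 2:] (Suc n))) j =
               q ^ Suc (Suc n) * (case j of 0 \<Rightarrow> 0 | Suc i \<Rightarrow> ?b (n + j) (Suc (2 * i)))"
    using ge2(2)[of "j - 1"] by (cases j) (simp_all add: mult.assoc)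
  also have "2 * q * (q ^ Suc j * ?u (Suc n) j) - q ^ 2 * (q ^ Suc j * ?u n j) + \<dots> =
               q ^ Suc (Suc n) * (2 * ?b (Suc n + j) (Suc (2 * j)) - ?b (n + j) (Suc (2 * j))
                 + (case j of 0 \<Rightarrow> 0 | Suc i \<Rightarrow> ?b (n + j) (Suc (2 * i))))"
    unfolding ge2 by (simp add: algebra_simps power2_eq_square)
  \<comment> \<open>By Pascal's rule, the second difference in the upper argument lowers the lower
    one by two; for j = 0 the binomial is linear and the difference is 0.\<close>
  also have "2 * ?b (Suc n + j) (Suc (2 * j)) - ?b (n + j) (Suc (2 * j))
                 + (case j of 0 \<Rightarrow> 0 | Suc i \<Rightarrow> ?b (n + j) (Suc (2 * i))) =
               ?b (Suc (Suc n) + j) (Suc (2 * j))"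
    by (cases j) simp_all
  finally show ?case .
qed (simp add: binomial_eq_0)

lemma lucas_linear:
  fixes a b :: "'a :: comm_ring_1"
  shows "degree (lucas [:a, 1:] [:b:] (Suc n)) \<le> n \<and> coeff (lucas [:a, 1:] [:b:] (Suc n)) n = 1"
proof (induction n rule: induct_nat_012)
  case (ge2 n)
  let ?u = "lucas [:a, 1:] [:b:]"
  have u: "?u (Suc (Suc (Suc n))) = smult a (?u (Suc (Suc n))) + pCons 0 (?u (Suc (Suc n))) - smult b (?u (Suc n))"
    by simp
  have "coeff (?u (Suc n)) i = 0" if "i > n" for i
    using ge2(1) that by (intro coeff_eq_0) linarith
  moreover have "coeff (?u (Suc (Suc n))) i = 0" if "i > Suc n" for i
    using ge2(2) that by (intro coeff_eq_0) linarith
  ultimately show ?case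
    using ge2 unfolding u
    by (auto intro!: degree_le simp: coeff_pCons simp del: lucas.simps split: nat.splits)
qed simp_all

lemma lucas_odd_linear:
  fixes a q :: int
  shows "degree (lucas_odd [:a, 1:] [:q:] m) = m" "coeff (lucas_odd [:a, 1:] [:q:] m) m = 1"
proof -
  have "[:a, 1:] - 2 * [:q:] = [:a - 2 * q, 1:]" by (simp add: numeral_poly)
  moreover have "[:q:] ^ 2 = [:q ^ 2:]" by (simp add: power2_eq_square)
  ultimately have eq: "lucas_odd [:a, 1:] [:q:] m =
      lucas [:a - 2 * q, 1:] [:q ^ 2:] (Suc m) + smult q (lucas [:a - 2 * q, 1:] [:q ^ 2:] m)"
    by (simp add: lucas_odd_def del: lucas.simps)
  have "coeff (lucas [:a - 2 * q, 1:] [:q ^ 2:] m) i = 0" if "i \<ge> m" for i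
  proof (cases m)
    case (Suc n)
    thus ?thesis
      using lucas_linear[of "a - 2 * q" "q ^ 2" n] that
      by (intro coeff_eq_0) (simp del: lucas.simps)
  qed simp
  moreover have "coeff (lucas [:a - 2 * q, 1:] [:q ^ 2:] (Suc m)) i = 0" if "i > m" for i
    using lucas_linear[of "a - 2 * q" "q ^ 2" m] that by (intro coeff_eq_0) linarith
  ultimately have le: "degree (lucas_odd [:a, 1:] [:q:] m) \<le> m"
    and "coeff (lucas_odd [:a, 1:] [:q:] m) m = 1"
    using lucas_linear[of "a - 2 * q" "q ^ 2" m] unfolding eq
    by (auto intro!: degree_le simp del: lucas.simps)
  thus "coeff (lucas_odd [:a, 1:] [:q:] m) m = 1" by blast
  thus "degree (lucas_odd [:a, 1:] [:q:] m) = m"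
    using le by (metis le_antisym le_degree zero_neq_one)
qed

text \<open>For a prime \<open>2m + 1\<close> and \<open>j < m\<close> it follows that \<open>2m + 1\<close> divides the sum on the left.\<close>

lemma binomial_odd_step:
  "Suc (2 * j) * ((Suc m + j choose Suc (2 * j)) + (m + j choose Suc (2 * j))) =
     Suc (2 * m) * (m + j choose (2 * j))"
proof -
  have "Suc (2 * j) * ((m + j choose (2 * j)) + (m + j choose Suc (2 * j))) =
          Suc (m + j) * (m + j choose (2 * j))"
    using Suc_times_binomial_eq[of "m + j" "2 * j"] by (simp add: mult.commute)
  thus ?thesis by (simp add: algebra_simps)
qed

section \<open>Irreducibility over the integers\<close>

text \<open>With a, b the roots of t^2 - x t + q and p = 2m + 1, modulo p one has (a^p - b^p)/(a -
  b) = (a - b)^(p - 1) = (x^2 - 4q)^m. This is why Eisenstein applies after translating by 4q; the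
  proof verifies it on explicit coefficients.\<close>

lemma irreducible_lucas_odd:
  fixes q :: int
  assumes p: "prime (Suc (2 * m))" and q: "\<not> int (Suc (2 * m)) dvd q"
  shows "irreducible (lucas_odd [:0, 1:] [:q:] m)"
proof -
  define p where "p = int (Suc (2 * m))"
  \<comment> \<open>The shift turns the Lucas parameter y - 2q into y + 2q, as
    \<open>coeff_lucas_shifted\<close> requires.\<close>
  define f where "f = lucas_odd [:4 * q, 1:] [:q:] m"
  have prime: "prime p" using p unfolding p_def prime_nat_int_transfer .
  have "q \<noteq> 0" using q by auto
  have "m > 0" using p by (cases m) auto
  have q_power: "\<not> p dvd q ^ n" for n
    using q prime by (metis p_def prime_dvd_power)
  have "[:4 * q, 1:] - 2 * [:q:] = [:2 * q, 1:]" by (simp add: numeral_poly)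
  moreover have "[:q:] ^ 2 = [:q ^ 2:]" by (simp add: power2_eq_square)
  ultimately have f_eq: "f = lucas [:2 * q, 1:] [:q ^ 2:] (Suc m) + [:q:] * lucas [:2 * q, 1:] [:q ^ 2:] m"
    by (simp only: f_def lucas_odd_def)
  have coeff: "q ^ Suc j * coeff f j =
      q ^ Suc m * of_nat ((Suc m + j choose Suc (2 * j)) + (m + j choose Suc (2 * j)))" for j
  proof -
    have "q ^ Suc j * coeff f j =
            q ^ Suc j * coeff (lucas [:2 * q, 1:] [:q ^ 2:] (Suc m)) j
            + q * (q ^ Suc j * coeff (lucas [:2 * q, 1:] [:q ^ 2:] m) j)"
      unfolding f_eq by (simp add: algebra_simps del: lucas.simps)
    thus ?thesis
      unfolding coeff_lucas_shifted by (simp add: algebra_simps)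
  qed
  have "irreducible f"
  proof (rule irreducible_Eisenstein_monic[of p])
    show "prime_elem p" using prime by (rule prime_imp_prime_elem)
    show "lead_coeff f = 1" "degree f > 0"
      using \<open>m > 0\<close> by (simp_all add: f_def lucas_odd_linear)
    show "p dvd coeff f j" if "j < degree f" for j
    proof -
      have j: "j < m" using that by (simp add: f_def lucas_odd_linear)
      have "p dvd int (Suc (2 * j) * ((Suc m + j choose Suc (2 * j)) + (m + j choose Suc (2 * j))))"
        unfolding binomial_odd_step p_def by (simp only: of_nat_mult dvd_triv_left)
      moreover have "\<not> p dvd int (Suc (2 * j))"
        unfolding p_def int_dvd_int_iff using j by (auto dest: dvd_imp_le)
      ultimately have "p dvd of_nat ((Suc m + j choose Suc (2 * j)) + (m + j choose Suc (2 * j)))"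
        using prime by (metis of_nat_mult prime_dvd_multD)
      hence "p dvd q ^ Suc j * coeff f j"
        unfolding coeff by (rule dvd_mult)
      thus ?thesis
        using prime q_power by (metis prime_dvd_multD)
    qed
    show "\<not> p ^ 2 dvd coeff f 0"
    proof
      assume "p ^ 2 dvd coeff f 0"
      hence "p * p dvd q ^ Suc 0 * coeff f 0"
        unfolding power2_eq_square by (rule dvd_mult)
      \<comment> \<open>At j = 0 the binomials are m + 1 and m, with sum p.\<close>
      also have "\<dots> = p * q ^ Suc m"
        unfolding coeff by (simp add: p_def)
      finally have "p dvd q ^ Suc m"
        using prime by (simp only: dvd_mult_cancel_left) auto
      thus False using q_power by blast
    qed
  qed
  \<comment> \<open>\<open>f\<close> is expanded in the discriminant \<open>x\<^sup>2 - 4q\<close>\<close>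
  hence "irreducible (pcompose f [:- 4 * q, 1:])"
    by (rule irreducible_pcompose[where l' = "[:4 * q, 1:]"]) (simp_all add: pcompose_pCons)
  also have "pcompose f [:- 4 * q, 1:] = lucas_odd [:0, 1:] [:q:] m"
    by (simp add: f_def pcompose_lucas_odd pcompose_pCons)
  finally show ?thesis .
qed

text \<open>Supplies the premise \<open>no_norm\<close>: the sign of \<open>L\<close> is forced, and
  then \<open>sum_squares_congruence\<close> makes 2 divide a polynomial having a coefficient
  1.\<close>

lemma lucas_odd_not_norm:
  fixes q :: int
  assumes q: "q * q = q + 2" and "m > 0" and "is_unit L"
  shows "E ^ 2 - [:0, 1:] * O' ^ 2 \<noteq> L * lucas_odd [:0, 1:] [:q:] m"
proof
  assume eq: "E ^ 2 - [:0, 1:] * O' ^ 2 = L * lucas_odd [:0, 1:] [:q:] m"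
  let ?y = "[:0, 1:] :: int poly"
  let ?G = "lucas_odd ?y [:q:]"
  let ?u = "lucas (?y - 2 * [:q:]) ([:q:] ^ 2)"
  have not_dvd: "\<not> [:2:] dvd f" if "coeff f n = 1" for f :: "int poly" and n
    using that by (auto simp: const_poly_dvd_iff intro: exI[of _ n])
  obtain c where L: "L = [:c:]" "is_unit c"
    using \<open>is_unit L\<close> by (auto simp: is_unit_poly_iff)
  have "c \<noteq> 0" using L by auto
  have G: "?G m \<noteq> 0" using lucas_odd_linear(2)[of 0 q m] by auto
  have "degree (L * ?G m) = m" "lead_coeff (L * ?G m) = c"
    using \<open>c \<noteq> 0\<close> by (simp_all add: L lucas_odd_linear)
  moreover have "L * ?G m \<noteq> 0" using G \<open>c \<noteq> 0\<close> by (simp add: L)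
  ultimately have "(- 1) ^ m * c > 0"
    using sgn_lead_coeff_square_diff[OF eq] by simp
  hence c: "c = (- 1) ^ m"
    using L(2) by (cases "even m") auto
  show False
  proof (cases "even m")
    case True
    \<comment> \<open>Half of \<open>m\<close> is written as a successor because
      \<open>?u (Suc n)\<close> has coefficient 1 at \<open>n\<close>.\<close>
    then obtain n where m: "m = 2 * Suc n"
      using \<open>m > 0\<close> by (metis evenE gr0_conv_Suc mult_0_right not_gr_zero)
    have "E ^ 2 - ?y * O' ^ 2 = ?G (Suc n) ^ 2 - [:q:] * ?y * ?u (Suc n) ^ 2"
      unfolding eq L c m lucas_odd_double by simp
    hence "[:2:] dvd ?u (Suc n)"
      by (intro sum_squares_congruence[OF q]) simp
    moreover have "?y - 2 * [:q:] = [:- 2 * q, 1:]" "[:q:] ^ 2 = [:q ^ 2:]"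
      by (simp_all add: numeral_poly power2_eq_square)
    ultimately show False
      using not_dvd[of "?u (Suc n)" n] lucas_linear[of "- 2 * q" "q ^ 2" n] by simp
  next
    case False
    then obtain k where m: "m = Suc (2 * k)"
      by (metis oddE Suc_eq_plus1)
    have "E ^ 2 - ?y * O' ^ 2 = - (?y * ?u (Suc k) ^ 2 - [:q:] * ?G k ^ 2)"
      unfolding eq L c m lucas_odd_Suc_double by simp
    moreover have "b - a = c" if "a - b = - c" for a b c :: "int poly"
      using that by (metis minus_diff_eq minus_minus)
    ultimately have "?y * O' ^ 2 - E ^ 2 = ?y * ?u (Suc k) ^ 2 - [:q:] * ?G k ^ 2"
      by blast
    \<comment> \<open>Multiplying by y restores the shape of the even case, with y O' and E as the
      two parts on the left and \<open>?G k\<close> in the role of C.\<close>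
    hence "?y * (?y * O' ^ 2 - E ^ 2) = ?y * (?y * ?u (Suc k) ^ 2 - [:q:] * ?G k ^ 2)"
      by (rule arg_cong)
    hence "(?y * O') ^ 2 - ?y * E ^ 2 = (?y * ?u (Suc k)) ^ 2 - [:q:] * ?y * ?G k ^ 2"
      by (simp only: power2_eq_square right_diff_distrib mult_ac)
    hence "[:2:] dvd ?G k"
      by (intro sum_squares_congruence[OF q]) simp
    thus False
      using not_dvd[of "?G k" k] lucas_odd_linear(2)[of 0 q k] by simp
  qed
qed

text \<open>The quadratic condition on \<open>q\<close> covers -1 and 2 at once, in the form in
  which the argument modulo 4 uses it.\<close>

lemma irreducible_lucas:
  fixes q :: int
  assumes p: "prime p" and q: "q * q = q + 2"
  shows "irreducible (lucas [:0, 1:] [:q:] p :: int poly)"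
proof (cases "p = 2")
  case True
  thus ?thesis by (simp add: numeral_2_eq_2 irreducible_linear_poly)
next
  case False
  hence "odd p" using p prime_odd_nat[of p] prime_gt_1_nat[of p] by (metis primes_dvd_imp_eq two_is_prime_nat)
  then obtain m where m: "p = Suc (2 * m)" by (metis oddE Suc_eq_plus1)
  have "m > 0" using p m by (cases m) auto
  have "(q + 1) * (q - 2) = 0" using q by (simp add: algebra_simps)
  hence "q = - 1 \<or> q = 2" by auto
  moreover have "\<not> int p dvd 1" "\<not> int p dvd 2"
    using \<open>m > 0\<close> m by (auto dest: zdvd_imp_le)
  ultimately have "\<not> int p dvd q" by auto
  hence "irreducible (pcompose (lucas_odd [:0, 1:] [:q:] m) X2)"
    using irreducible_lucas_odd[of m q] p lucas_odd_not_norm[OF q \<open>m > 0\<close>]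
    by (intro irreducible_pcompose_X2) (simp_all add: m)
  also have "pcompose (lucas_odd [:0, 1:] [:q:] m) X2 = lucas [:0, 1:] [:q:] p"
    by (simp add: m lucas_bisection(2) pcompose_lucas_odd pcompose_pCons power2_eq_square)
  finally show ?thesis .
qed

section \<open>Transfer to the rationals and the three families\<close>

text \<open>Substituting c x for x is invertible over Q. The pairs (q, c) = (-1, 1), (-1, 2), (2, 3)
  give the Fibonacci, Pell and Fermat polynomials.\<close>

lemma irreducible_lucas_rat:
  fixes q :: int and c :: rat
  assumes p: "prime p" and q: "q * q = q + 2" and c: "c \<noteq> 0"
  shows "irreducible (lucas [:0, c:] [:of_int q:] p)"
proof -
  have "degree (lucas [:0, 1:] [:q:] p) > 0"
  proof -
    have "p > 1" using p by (rule prime_gt_1_nat)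
    then obtain n where n: "p = Suc n" "n > 0"
      by (cases p) auto
    have "coeff (lucas [:0, 1:] [:q:] p) n = 1"
      unfolding n(1) using lucas_linear[of 0 q n] by (rule conjunct2)
    hence "n \<le> degree (lucas [:0, 1:] [:q:] p)"
      by (intro le_degree) simp
    thus ?thesis using n(2) by linarith
  qed
  with irreducible_lucas[OF p q] have "irreducible (rat_poly (lucas [:0, 1:] [:q:] p))"
    by (rule irreducible_rat_poly)
  hence "irreducible (pcompose (rat_poly (lucas [:0, 1:] [:q:] p)) [:0, c:])"
    by (rule irreducible_pcompose[where l' = "[:0, inverse c:]"])
      (use c in \<open>simp_all add: pcompose_pCons\<close>)
  moreover have "pcompose (rat_poly [:0, 1:]) [:0, c:] = [:0, c:]"
    "pcompose (rat_poly [:q:]) [:0, c:] = [:of_int q:]"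
    by (simp_all add: map_poly_pCons pcompose_pCons)
  ultimately show ?thesis
    unfolding rat_poly_lucas pcompose_lucas by argo
qed

lemma fibonacci_poly_eq_lucas: "fibonacci_poly n = lucas [:0, 1:] [:- 1:] n"
  by (induction n rule: fibonacci_poly.induct) simp_all

lemma pell_poly_eq_lucas: "pell_poly n = lucas [:0, 2:] [:- 1:] n"
  by (induction n rule: pell_poly.induct) simp_all

lemma fermat_poly_eq_lucas: "fermat_poly n = lucas [:0, 3:] [:2:] n"
  by (induction n rule: fermat_poly.induct) (simp_all add: numeral_poly)

theorem mainTheorem8:
  fixes p :: nat
  assumes "prime p"
  shows "irreducible (fibonacci_poly p) \<and> irreducible (pell_poly p) \<and> irreducible (fermat_poly p)"
  using irreducible_lucas_rat[OF assms, of "- 1" 1] irreducible_lucas_rat[OF assms, of "- 1" 2]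
    irreducible_lucas_rat[OF assms, of 2 3]
  by (simp add: fibonacci_poly_eq_lucas pell_poly_eq_lucas fermat_poly_eq_lucas)

end
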